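(* Let $G$ be a finite group. If $(K,\overline{\sigma})\models G\text{-TCF}$, then $K$ is a PAC (pseudo-algebraically closed) field.
   Context: $G=\{g_1,\dots,g_e\}$ is a finite group of order $e$ with neutral element $g_1=1$. $\mathcal{L}_G$ is the language of rings with $e$ additional unary function symbols $\sigma_1,\dots,\sigma_e$; write $\sigma_{g_k}=\sigma_k$ and $\overline{\sigma}=(\sigma_1,\dots,\sigma_e)$. A $G$-transformal ring (resp. field) is an $\mathcal{L}_G$-structure $(R,\overline{\sigma})$ such that $R$ is a commutative ring (resp. a field) and $g_k\mapsto\sigma_k$ is a group homomorphism $G\to\mathrm{Aut}(R)$. For a tuple $a$, $\sigma_k(a)$ is taken coordinatewise and $\overline{\sigma}(a)=(\sigma_1(a),\dots,\sigma_e(a))$. Let $G$ act on $\{1,\dots,e\}$ by $g_k\ast l=j$ iff $g_kg_l=g_j$. For $n\geq 1$ let $\mathbf{X}_i=(X_{i,1},\dots,X_{i,n})$, $i\leq e$, be $n$-tuples of variables. For a $G$-transformal field $(K,\overline{\sigma})$, the ring $K[\mathbf{X}_1,\dots,\mathbf{X}_e]$ is a $G$-transformal ring via $\sigma_{g_k}(f(\mathbf{X}_1,\dots,\mathbf{X}_e))=f^{\sigma_{g_k}}(\mathbf{X}_{g_k\ast 1},\dots,\mathbf{X}_{g_k\ast e})$, where $f^{\sigma}$ is obtained by applying $\sigma$ to the coefficients. An ideal $I$ is $G$-invariant if $\sigma_k(I)\subseteq I$ for all $k\leq e$. Put $V_K(I)=\{r\in K^{ne}: f(r)=0\text{ for all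 }f\in I\}$. A $G$-transformal field $(K,\overline{\sigma})$ is a model of $G$-TCF if for every $n\geq 1$ and all ideals $I,J$ of $K[\mathbf{X}_1,\dots,\mathbf{X}_e]$ such that $I\subsetneq J$ and $I$ is a $G$-invariant prime ideal, there is $a\in K^n$ with $\overline{\sigma}(a)\in V_K(I)\setminus V_K(J)$. A field $F$ is PAC if every absolutely irreducible $F$-variety has an $F$-rational point. *)

theory Defs
  imports
    "HOL-Library.Poly_Mapping"
    "HOL-Library.FuncSet"
    "HOL-Algebra.Algebraic_Closure_Type"
    "HOL-Algebra.QuotRing"
begin

section \<open>Multivariate polynomials\<close>

text \<open>
  A polynomial is a finitely supported map from monomials to coefficients, and a monomial is a
  finitely supported map from variables to exponents.
\<close>

type_synonym ('v, 'a) mpoly = "('v \<Rightarrow>\<^sub>0 nat) \<Rightarrow>\<^sub>0 'a"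

definition Const :: "'a::zero \<Rightarrow> ('v, 'a) mpoly"
  where "Const c = Poly_Mapping.single 0 c"

definition Var :: "'v \<Rightarrow> ('v, 'a::zero_neq_one) mpoly"
  where "Var v = Poly_Mapping.single (Poly_Mapping.single v 1) 1"

definition vars :: "('v, 'a::zero) mpoly \<Rightarrow> 'v set"
  where "vars f = (\<Union>m\<in>Poly_Mapping.keys f. Poly_Mapping.keys m)"

text \<open>
  Substitution of \<open>x v\<close> for the variable \<open>v\<close>, where the coefficients are carried along a map \<open>\<phi>\<close>
  (a ring homomorphism in all uses) into the ring containing the values \<open>x v\<close>.
\<close>

definition mpoly_subst :: "('a::zero \<Rightarrow> 'b::comm_semiring_1) \<Rightarrow> ('v \<Rightarrow> 'b) \<Rightarrow> ('v, 'a) mpoly \<Rightarrow> 'b"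
  where "mpoly_subst \<phi> x f =
    (\<Sum>m\<in>Poly_Mapping.keys f. \<phi> (Poly_Mapping.lookup f m) *
       (\<Prod>v\<in>Poly_Mapping.keys m. x v ^ Poly_Mapping.lookup m v))"

abbreviation mpoly_eval :: "('v \<Rightarrow> 'a::comm_semiring_1) \<Rightarrow> ('v, 'a) mpoly \<Rightarrow> 'a"
  where "mpoly_eval \<equiv> mpoly_subst id"

text \<open>The polynomial ring in the variables \<open>V\<close>.\<close>

definition mpoly_ring :: "'v set \<Rightarrow> ('v, 'a::comm_ring_1) mpoly ring"
  where "mpoly_ring V =
    \<lparr> carrier = {f. vars f \<subseteq> V}, monoid.mult = (*), one = 1, ring.zero = 0, add = (+) \<rparr>"

text \<open>
  The points of the affine space with coordinates indexed by \<open>V\<close> are the extensional functions on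
  \<open>V\<close>, so that two points are equal iff they have the same coordinates.
\<close>

definition affine_space :: "'v set \<Rightarrow> ('v \<Rightarrow> 'a) set"
  where "affine_space V = V \<rightarrow>\<^sub>E UNIV"

definition zero_locus :: "'v set \<Rightarrow> ('v, 'a::comm_ring_1) mpoly set \<Rightarrow> ('v \<Rightarrow> 'a) set"
  where "zero_locus V S = {r \<in> affine_space V. \<forall>f\<in>S. mpoly_eval r f = 0}"

definition vanishing_ideal :: "'v set \<Rightarrow> ('v \<Rightarrow> 'a::comm_ring_1) set \<Rightarrow> ('v, 'a) mpoly set"
  where "vanishing_ideal V W = {f \<in> carrier (mpoly_ring V). \<forall>r\<in>W. mpoly_eval r f = 0}"


section \<open>Transformal fields and \<open>G\<close>-TCF\<close>

definition ring_Aut :: "('a::ring_1 \<Rightarrow> 'a) monoid"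
  where "ring_Aut =
    \<lparr> carrier = ring_iso ring_of_type_algebra ring_of_type_algebra, monoid.mult = (\<circ>), one = id \<rparr>"

definition transformal_field :: "('g, 'm) monoid_scheme \<Rightarrow> ('g \<Rightarrow> 'k::field \<Rightarrow> 'k) \<Rightarrow> bool"
  where "transformal_field G \<sigma> \<longleftrightarrow> \<sigma> \<in> hom G ring_Aut"

text \<open>
  The tuples of variables, and the automorphisms, are indexed by the elements of \<open>G\<close> themselves
  rather than by their positions in an enumeration \<open>g\<^sub>1, \<dots>, g\<^sub>e\<close>.  The variable \<open>X\<^bsub>k,i\<^esub>\<close> is
  \<open>(g\<^sub>k, i)\<close>, and the action \<open>k \<star> l\<close> on indices is then left multiplication in \<open>G\<close>.
\<close>

definition transformal_vars :: "('g, 'm) monoid_scheme \<Rightarrow> nat \<Rightarrow> ('g \<times> nat) set"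
  where "transformal_vars G n = carrier G \<times> {1..n}"

definition poly_action ::
  "('g, 'm) monoid_scheme \<Rightarrow> ('g \<Rightarrow> 'k::field \<Rightarrow> 'k) \<Rightarrow> 'g \<Rightarrow>
     ('g \<times> nat, 'k) mpoly \<Rightarrow> ('g \<times> nat, 'k) mpoly"
  where "poly_action G \<sigma> g f =
    mpoly_subst Const (\<lambda>(h, i). Var (g \<otimes>\<^bsub>G\<^esub> h, i)) (Poly_Mapping.map (\<sigma> g) f)"

definition G_invariant ::
  "('g, 'm) monoid_scheme \<Rightarrow> ('g \<Rightarrow> 'k::field \<Rightarrow> 'k) \<Rightarrow> ('g \<times> nat, 'k) mpoly set \<Rightarrow> bool"
  where "G_invariant G \<sigma> I \<longleftrightarrow> (\<forall>g\<in>carrier G. poly_action G \<sigma> g ` I \<subseteq> I)"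

text \<open>The tuple \<open>(\<sigma>\<^sub>1(a), \<dots>, \<sigma>\<^sub>e(a))\<close> for an \<open>n\<close>-tuple \<open>a\<close>.\<close>

definition sigma_bar ::
  "('g, 'm) monoid_scheme \<Rightarrow> ('g \<Rightarrow> 'k \<Rightarrow> 'k) \<Rightarrow> nat \<Rightarrow> (nat \<Rightarrow> 'k) \<Rightarrow> 'g \<times> nat \<Rightarrow> 'k"
  where "sigma_bar G \<sigma> n a = restrict (\<lambda>(g, i). \<sigma> g (a i)) (transformal_vars G n)"

definition model_G_TCF :: "('g, 'm) monoid_scheme \<Rightarrow> ('g \<Rightarrow> 'k::field \<Rightarrow> 'k) \<Rightarrow> bool"
  where "model_G_TCF G \<sigma> \<longleftrightarrow>
    transformal_field G \<sigma> \<and>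
    (\<forall>n\<ge>1. \<forall>I J.
       ideal I (mpoly_ring (transformal_vars G n)) \<and>
       ideal J (mpoly_ring (transformal_vars G n)) \<and>
       I \<subset> J \<and>
       G_invariant G \<sigma> I \<and>
       primeideal I (mpoly_ring (transformal_vars G n)) \<longrightarrow>
       (\<exists>a\<in>affine_space {1..n}.
          sigma_bar G \<sigma> n a \<in>
            zero_locus (transformal_vars G n) I - zero_locus (transformal_vars G n) J))"


section \<open>Pseudo-algebraically closed fields\<close>

definition algebraic_set :: "'v set \<Rightarrow> ('v \<Rightarrow> 'a::field) set \<Rightarrow> bool"
  where "algebraic_set V W \<longleftrightarrow> (\<exists>S \<subseteq> carrier (mpoly_ring V). W = zero_locus V S)"

text \<open>
  An (affine) \<open>F\<close>-variety is an algebraic set \<open>W\<close> over the algebraic closure of \<open>F\<close> that is defined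
  over \<open>F\<close>, i.e. whose vanishing ideal is generated by polynomials over \<open>F\<close>.  If \<open>F\<close> is imperfect,
  this is stronger than \<open>W\<close> being the zero locus of polynomials over \<open>F\<close>.  For example, if
  \<open>a\<close> is not a \<open>p\<close>-th power in a field \<open>F\<close> of characteristic \<open>p\<close>, then the single zero of
  \<open>X\<^sup>p - a\<close> is not an \<open>F\<close>-variety.
\<close>

definition F_variety :: "nat \<Rightarrow> (nat \<Rightarrow> 'f::field alg_closure) set \<Rightarrow> bool"
  where "F_variety n W \<longleftrightarrow>
    algebraic_set {1..n} W \<and>
    (\<exists>S :: (nat, 'f) mpoly set.
       S \<subseteq> carrier (mpoly_ring {1..n}) \<and>
       vanishing_ideal {1..n} W = Idl\<^bsub>mpoly_ring {1..n}\<^esub> (Poly_Mapping.map to_ac ` S))"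

text \<open>
  Irreducibility in the Zariski topology over the algebraic closure.  Irreducible sets are nonempty.
\<close>

definition absolutely_irreducible :: "nat \<Rightarrow> (nat \<Rightarrow> 'f::field alg_closure) set \<Rightarrow> bool"
  where "absolutely_irreducible n W \<longleftrightarrow>
    W \<noteq> {} \<and>
    (\<forall>A B. algebraic_set {1..n} A \<and> algebraic_set {1..n} B \<and> W = A \<union> B \<longrightarrow> W = A \<or> W = B)"

definition F_rational :: "nat \<Rightarrow> (nat \<Rightarrow> 'f::field alg_closure) \<Rightarrow> bool"
  where "F_rational n x \<longleftrightarrow> (\<forall>i\<in>{1..n}. x i \<in> range to_ac)"

definition PAC_field :: "'f::field itself \<Rightarrow> bool"
  where "PAC_field TYPE('f) \<longleftrightarrow>
    (\<forall>n. \<forall>W :: (nat \<Rightarrow> 'f alg_closure) set.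
       F_variety n W \<and> absolutely_irreducible n W \<longrightarrow> (\<exists>x\<in>W. F_rational n x))"

end

theory Submission
  imports Defs
begin

text \<open>
  Extend every \<open>\<sigma> g\<close> to an automorphism \<open>\<tau> g\<close> of the algebraic closure.  If \<open>W\<close> is an absolutely
  irreducible variety with equations \<open>S\<close> over \<open>'k\<close>, then the zero locus of the conjugate of \<open>S\<close>
  under \<open>\<sigma> g\<close> is \<open>\<tau> g(W)\<close>, hence irreducible.  A product of irreducible sets over an integral
  domain is irreducible, so the polynomials over \<open>'k\<close> vanishing on the product of all \<open>\<tau> g(W)\<close> form
  a prime ideal \<open>I\<close>, and \<open>G\<close> permutes the factors, so \<open>I\<close> is \<open>G\<close>-invariant.  The axiom of \<open>G\<close>-TCF
  with \<open>J\<close> the unit ideal yields a tuple \<open>a\<close> over \<open>'k\<close> whose conjugates satisfy \<open>I\<close>.  Since \<open>I\<close>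
  contains \<open>S\<close> written in the variables indexed by the neutral element, \<open>a\<close> is a point of \<open>W\<close>.
\<close>


section \<open>Extending automorphisms to the algebraic closure\<close>

locale ring_morphism =
  fixes \<theta> :: "'a::comm_ring_1 \<Rightarrow> 'b::comm_ring_1"
  assumes map_add: "\<theta> (x + y) = \<theta> x + \<theta> y"
    and map_mult: "\<theta> (x * y) = \<theta> x * \<theta> y"
    and map_one: "\<theta> 1 = 1"
begin

lemma map_zero: "\<theta> 0 = 0"
  using map_add[of 0 0] by simp

lemma map_uminus: "\<theta> (- x) = - \<theta> x"
  using map_add[of x "- x"] by (simp add: map_zero eq_neg_iff_add_eq_0 add.commute)

lemma map_sum: "\<theta> (\<Sum>i\<in>A. f i) = (\<Sum>i\<in>A. \<theta> (f i))"
  by (induction A rule: infinite_finite_induct) (auto simp: map_zero map_add)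

lemma map_prod: "\<theta> (\<Prod>i\<in>A. f i) = (\<Prod>i\<in>A. \<theta> (f i))"
  by (induction A rule: infinite_finite_induct) (auto simp: map_one map_mult)

lemma map_power: "\<theta> (x ^ n) = \<theta> x ^ n"
  by (induction n) (auto simp: map_one map_mult)

end

lemma ring_morphism_to_ac: "ring_morphism to_ac"
  by unfold_locales auto

lemma ring_morphism_comp:
  assumes "ring_morphism \<theta>" "ring_morphism \<psi>"
  shows "ring_morphism (\<psi> \<circ> \<theta>)"
proof -
  interpret \<theta>: ring_morphism \<theta> by fact
  interpret \<psi>: ring_morphism \<psi> by fact
  show ?thesis
    by unfold_locales
      (auto simp: \<theta>.map_add \<theta>.map_mult \<theta>.map_one \<psi>.map_add \<psi>.map_mult \<psi>.map_one)
qed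

lemma ring_morphism_inv:
  assumes "ring_morphism \<theta>" "bij \<theta>"
  shows "ring_morphism (inv_into UNIV \<theta>)"
proof -
  interpret ring_morphism \<theta> by fact
  have inj: "inj \<theta>" and surj: "surj \<theta>"
    using assms(2) by (auto simp: bij_def)
  show ?thesis
    by unfold_locales
      (auto intro!: inv_f_eq[OF inj] simp: map_add map_mult map_one surj_f_inv_f[OF surj])
qed

lemma ring_morphism_field_inj:
  fixes \<theta> :: "'a::field \<Rightarrow> 'b::field"
  assumes "ring_morphism \<theta>"
  shows "inj \<theta>"
proof (rule injI)
  interpret ring_morphism \<theta> by fact
  fix x y assume "\<theta> x = \<theta> y"
  then have z: "\<theta> (x - y) = 0"
    using map_add[of x "- y"] by (simp add: map_uminus)
  show "x = y"
  proof (rule ccontr)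
    assume "x \<noteq> y"
    then have "\<theta> (x - y) * \<theta> (inverse (x - y)) = 1"
      by (simp flip: map_mult add: map_one)
    with z show False by simp
  qed
qed

text \<open>Partial extensions of \<open>\<theta>\<close> are represented by their graphs.\<close>

locale partial_extension =
  ring_morphism \<theta> for \<theta> :: "'k::field \<Rightarrow> 'a::alg_closed_field" +
  fixes \<Gamma> :: "('k alg_closure \<times> 'a) set"
  assumes base: "(to_ac c, \<theta> c) \<in> \<Gamma>"
    and add: "(a, b) \<in> \<Gamma> \<Longrightarrow> (a', b') \<in> \<Gamma> \<Longrightarrow> (a + a', b + b') \<in> \<Gamma>"
    and mult: "(a, b) \<in> \<Gamma> \<Longrightarrow> (a', b') \<in> \<Gamma> \<Longrightarrow> (a * a', b * b') \<in> \<Gamma>"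
    and consistent: "(0, b) \<in> \<Gamma> \<Longrightarrow> b = 0"
begin

lemma zero: "(0, 0) \<in> \<Gamma>"
  using base[of 0] by (simp add: map_zero)

lemma one: "(1, 1) \<in> \<Gamma>"
  using base[of 1] by (simp add: map_one)

lemma uminus: "(a, b) \<in> \<Gamma> \<Longrightarrow> (- a, - b) \<in> \<Gamma>"
  using mult[OF base[of "- 1"]] by (force simp: map_uminus map_one)

lemma diff: "(a, b) \<in> \<Gamma> \<Longrightarrow> (a', b') \<in> \<Gamma> \<Longrightarrow> (a - a', b - b') \<in> \<Gamma>"
  using add[OF _ uminus] by fastforce

lemma functional: "(a, b) \<in> \<Gamma> \<Longrightarrow> (a, b') \<in> \<Gamma> \<Longrightarrow> b = b'"
  using diff consistent by fastforce

lemma sum: "(\<And>i. i \<in> I \<Longrightarrow> (f i, g i) \<in> \<Gamma>) \<Longrightarrow> (\<Sum>i\<in>I. f i, \<Sum>i\<in>I. g i) \<in> \<Gamma>"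
  by (induction I rule: infinite_finite_induct) (auto intro: zero add)

lemma poly_base:
  assumes "(a, b) \<in> \<Gamma>"
  shows "(poly (map_poly to_ac p) a, poly (map_poly \<theta> p) b) \<in> \<Gamma>"
  by (induction p) (auto simp: map_poly_pCons map_zero intro!: zero add mult base assms)

text \<open>The locale axioms give a ring only; inverses come from algebraicity. If c + a q(a) = 0
  with c nonzero, then -q(a)/c is the inverse of a, and \<open>poly_base\<close> supplies a partner
  for it. If c = 0, the factor a cancels and q replaces the polynomial.\<close>

lemma inverse:
  assumes ab: "(a, b) \<in> \<Gamma>" and "a \<noteq> 0"
  shows "\<exists>b'. (inverse a, b') \<in> \<Gamma>"
proof -
  obtain p where "p \<noteq> 0" "poly (map_poly to_ac p) a = 0"
    using alg_closure_algebraic by blast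
  then show ?thesis
  proof (induction p)
    case (pCons c q)
    show ?case
    proof (cases "c = 0")
      case True
      then show ?thesis using pCons \<open>a \<noteq> 0\<close> by (simp add: map_poly_pCons)
    next
      case False
      have "inverse a = poly (map_poly to_ac q) a * to_ac (- inverse c)"
        using pCons.prems False \<open>a \<noteq> 0\<close>
        by (simp add: map_poly_pCons field_simps eq_neg_iff_add_eq_0)
      then show ?thesis using mult[OF poly_base[OF ab] base] by metis
    qed
  qed simp
qed

text \<open>As \<open>\<Gamma>\<close> is functional, g is f with the partial map applied to its
  coefficients. The relational form lets polynomials over the domain of \<open>\<Gamma>\<close> be
  handled as polynomials over the whole closure.\<close>

definition graph_poly :: "'k alg_closure poly \<Rightarrow> 'a poly \<Rightarrow> bool" where
  "graph_poly f g \<longleftrightarrow> (\<forall>i. (poly.coeff f i, poly.coeff g i) \<in> \<Gamma>)"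

lemma graph_poly_0: "graph_poly 0 g \<Longrightarrow> g = 0"
  by (auto simp: graph_poly_def poly_eq_iff consistent)

lemma graph_poly_const: "(a, b) \<in> \<Gamma> \<Longrightarrow> graph_poly [:a:] [:b:]"
  by (auto simp: graph_poly_def coeff_pCons zero split: nat.split)

lemma graph_poly_X: "graph_poly [:0, 1:] [:0, 1:]"
  by (auto simp: graph_poly_def coeff_pCons zero one split: nat.split)

lemma graph_poly_add: "graph_poly f g \<Longrightarrow> graph_poly f' g' \<Longrightarrow> graph_poly (f + f') (g + g')"
  by (auto simp: graph_poly_def add)

lemma graph_poly_diff: "graph_poly f g \<Longrightarrow> graph_poly f' g' \<Longrightarrow> graph_poly (f - f') (g - g')"
  by (auto simp: graph_poly_def diff)

lemma graph_poly_mult: "graph_poly f g \<Longrightarrow> graph_poly f' g' \<Longrightarrow> graph_poly (f * f') (g * g')"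
  by (auto simp: graph_poly_def coeff_mult intro!: sum mult)

lemma graph_poly_monom: "(a, b) \<in> \<Gamma> \<Longrightarrow> graph_poly (Polynomial.monom a n) (Polynomial.monom b n)"
  by (auto simp: graph_poly_def zero)

text \<open>The witness is a root of the image of the minimal polynomial of z over the domain of
  \<open>\<Gamma>\<close>. Every f with root z is a multiple of that polynomial, and the
  factorization carries over to g.\<close>

lemma obtain_image:
  "\<exists>w. \<forall>f g. graph_poly f g \<longrightarrow> poly f z = 0 \<longrightarrow> poly g w = 0"
proof -
  define P where "P p \<longleftrightarrow> p \<noteq> 0 \<and> poly p z = 0 \<and> (\<exists>q. graph_poly p q)" for p
  have "\<exists>p. P p"
  proof -
    obtain p where "p \<noteq> 0" "poly (map_poly to_ac p) z = 0"
      using alg_closure_algebraic by blast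
    moreover have "graph_poly (map_poly to_ac p) (map_poly \<theta> p)"
      by (simp add: graph_poly_def coeff_map_poly map_zero base)
    moreover have "map_poly to_ac p \<noteq> 0"
      using \<open>p \<noteq> 0\<close> by (auto simp: poly_eq_iff coeff_map_poly)
    ultimately show ?thesis unfolding P_def by blast
  qed
  then obtain p where p: "P p" and least: "\<And>f. P f \<Longrightarrow> Polynomial.degree p \<le> Polynomial.degree f"
    using exists_least_iff[of "\<lambda>n. \<exists>p. P p \<and> Polynomial.degree p = n"] by (metis not_le_imp_less)
  obtain q where pq: "graph_poly p q" using p by (auto simp: P_def)
  let ?d = "Polynomial.degree p"
  have lead: "(poly.coeff p ?d, poly.coeff q ?d) \<in> \<Gamma>" and "poly.coeff p ?d \<noteq> 0"
    using pq p by (auto simp: graph_poly_def P_def)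
  then obtain c where c: "(inverse (poly.coeff p ?d), c) \<in> \<Gamma>" using inverse by blast
  \<comment> \<open>Making p monic makes its image monic in the same degree, since functionality
    forces the partner of 1 to be 1. So \<open>q'\<close> has positive degree and hence a
    root.\<close>
  define p' where "p' = [:inverse (poly.coeff p ?d):] * p"
  define q' where "q' = [:c:] * q"
  have p'q': "graph_poly p' q'"
    unfolding p'_def q'_def by (intro graph_poly_mult graph_poly_const pq c)
  have deg_p': "Polynomial.degree p' = ?d" and p'_lead: "poly.coeff p' ?d = 1"
    and p'_z: "poly p' z = 0"
    using p by (auto simp: p'_def P_def)
  have q'_lead: "poly.coeff q' ?d = 1"
    using p'q' p'_lead functional one unfolding graph_poly_def by metis
  have "?d > 0"
  proof (rule ccontr)
    assume "\<not> ?d > 0"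
    then obtain a where "p = [:a:]" by (metis degree_eq_zeroE not_gr_zero)
    then show False using p by (auto simp: P_def)
  qed
  moreover have "?d \<le> Polynomial.degree q'" by (rule le_degree) (simp add: q'_lead)
  ultimately obtain w where w: "poly q' w = 0"
    using alg_closed_imp_poly_has_root[of q'] by force
  have "poly g w = 0" if "graph_poly f g" "poly f z = 0" for f g
    using that
  \<comment> \<open>Division by \<open>p'\<close>, run in parallel on both sides of
    \<open>\<Gamma>\<close>.\<close>
  proof (induction "Polynomial.degree f" arbitrary: f g rule: less_induct)
    case less
    show ?case
    proof (cases "f = 0")
      case True
      then show ?thesis using graph_poly_0 less.prems by fastforce
    next
      case False
      let ?n = "Polynomial.degree f"
      define m where "m = Polynomial.monom (poly.coeff f ?n) (?n - ?d)"
      \<comment> \<open>The coefficient of g is taken at the degree of f, not of g, so that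
        \<open>m\<close> and \<open>m'\<close> are related by \<open>\<Gamma>\<close>.\<close>
      define m' where "m' = Polynomial.monom (poly.coeff g ?n) (?n - ?d)"
      have "?d \<le> ?n" using least False less.prems by (auto simp: P_def)
      have gp: "graph_poly (f - m * p') (g - m' * q')"
        using less.prems(1) unfolding m_def m'_def
        by (intro graph_poly_diff graph_poly_mult graph_poly_monom p'q') (auto simp: graph_poly_def)
      have z0: "poly (f - m * p') z = 0" using less.prems p'_z by simp
      have "poly (g - m' * q') w = 0"
      \<comment> \<open>In degree 0 the bound \<open>?n - 1\<close> would give no descent; the case
        is contradictory because \<open>0 < ?d\<close> and \<open>?d \<le> ?n\<close>.\<close>
      proof (cases "?n = 0")
        case True
        then show ?thesis using \<open>?d > 0\<close> \<open>?d \<le> ?n\<close> by simp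
      next
        case False
        have "poly.coeff (f - m * p') i = 0" if "i \<ge> ?n" for i
        proof (cases "i = ?n")
          case True
          then show ?thesis
            using \<open>?d \<le> ?n\<close> by (simp add: m_def coeff_monom_mult p'_lead)
        next
          case False
          then have "i > ?n" "i - (?n - ?d) > ?d" using that \<open>?d \<le> ?n\<close> by auto
          then show ?thesis
            by (simp add: m_def coeff_monom_mult coeff_eq_0 deg_p')
        qed
        then have "Polynomial.degree (f - m * p') \<le> ?n - 1"
          by (intro degree_le) auto
        then show ?thesis using less.hyps[OF _ gp z0] False by simp
      qed
      then show ?thesis using w by simp
    qed
  qed
  then show ?thesis by blast
qed

text \<open>The new graph is the subring generated by \<open>\<Gamma>\<close> and (z, w). Its
  consistency is exactly the property for which w was chosen.\<close>

lemma extend_by_element: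
  "\<exists>\<Gamma>'. partial_extension \<theta> \<Gamma>' \<and> \<Gamma> \<subseteq> \<Gamma>' \<and> z \<in> fst ` \<Gamma>'"
proof -
  obtain w where w: "\<And>f g. graph_poly f g \<Longrightarrow> poly f z = 0 \<Longrightarrow> poly g w = 0"
    using obtain_image by blast
  define \<Gamma>' where "\<Gamma>' = {(poly f z, poly g w) | f g. graph_poly f g}"
  have memI: "(a, b) \<in> \<Gamma>'" if "graph_poly f g" "a = poly f z" "b = poly g w" for a b f g
    using that by (auto simp: \<Gamma>'_def)
  have sub: "\<Gamma> \<subseteq> \<Gamma>'"
    by (auto intro!: memI[OF graph_poly_const])
  have "(z, w) \<in> \<Gamma>'"
    by (rule memI[OF graph_poly_X]) auto
  moreover have "partial_extension \<theta> \<Gamma>'"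
  proof unfold_locales
    fix c show "(to_ac c, \<theta> c) \<in> \<Gamma>'" using base sub by blast
  next
    fix a b a' b' assume "(a, b) \<in> \<Gamma>'" "(a', b') \<in> \<Gamma>'"
    then obtain f g f' g' where *: "graph_poly f g" "graph_poly f' g'"
      "a = poly f z" "b = poly g w" "a' = poly f' z" "b' = poly g' w"
      by (auto simp: \<Gamma>'_def)
    show "(a + a', b + b') \<in> \<Gamma>'"
      by (rule memI[OF graph_poly_add]) (use * in auto)
    show "(a * a', b * b') \<in> \<Gamma>'"
      by (rule memI[OF graph_poly_mult]) (use * in auto)
  next
    fix b assume "(0, b) \<in> \<Gamma>'"
    then show "b = 0" by (auto simp: \<Gamma>'_def dest: w)
  qed
  ultimately show ?thesis using sub by force
qed

end

section \<open>Maximal partial extensions and automorphisms of the closure\<close>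

lemma partial_extension_Union:
  assumes "\<C> \<noteq> {}" "subset.chain {\<Gamma>. partial_extension \<theta> \<Gamma>} \<C>"
  shows "partial_extension \<theta> (\<Union>\<C>)"
proof -
  have pe: "partial_extension \<theta> \<Gamma>" if "\<Gamma> \<in> \<C>" for \<Gamma>
    using assms(2) that by (auto simp: subset.chain_def)
  obtain \<Gamma>\<^sub>0 where \<Gamma>\<^sub>0: "\<Gamma>\<^sub>0 \<in> \<C>" using assms(1) by blast
  interpret partial_extension \<theta> \<Gamma>\<^sub>0 using pe[OF \<Gamma>\<^sub>0] .
  show ?thesis
  proof unfold_locales
    fix c show "(to_ac c, \<theta> c) \<in> \<Union>\<C>" using base \<Gamma>\<^sub>0 by blast
  next
    fix a b a' b' assume "(a, b) \<in> \<Union>\<C>" "(a', b') \<in> \<Union>\<C>"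
    \<comment> \<open>Two pairs lie in two members of the chain, and the larger member contains
      both.\<close>
    then obtain \<Gamma> where \<Gamma>: "\<Gamma> \<in> \<C>" "(a, b) \<in> \<Gamma>" "(a', b') \<in> \<Gamma>"
      using assms(2) unfolding subset.chain_def by blast
    interpret \<Gamma>: partial_extension \<theta> \<Gamma> using pe[OF \<Gamma>(1)] .
    show "(a + a', b + b') \<in> \<Union>\<C>" "(a * a', b * b') \<in> \<Union>\<C>"
      using \<Gamma>.add \<Gamma>.mult \<Gamma> by blast+
  next
    fix b assume "(0, b) \<in> \<Union>\<C>"
    then show "b = 0" using pe partial_extension.consistent by fast
  qed
qed

text \<open>Zorn's lemma, started at the graph of \<open>\<theta>\<close>, gives a maximal graph. It
  is total, since a missing element could still be adjoined.\<close>

lemma ring_morphism_extends_to_alg_closure: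
  fixes \<theta> :: "'k::field \<Rightarrow> 'a::alg_closed_field"
  assumes "ring_morphism \<theta>"
  shows "\<exists>\<tau>. ring_morphism \<tau> \<and> (\<forall>c. \<tau> (to_ac c) = \<theta> c)"
proof -
  interpret ring_morphism \<theta> by fact
  have "partial_extension \<theta> (range (\<lambda>c. (to_ac c, \<theta> c)))"
    by unfold_locales
      (auto simp: map_zero map_add map_mult simp flip: to_ac_add to_ac_mult)
  then obtain \<Gamma> where \<Gamma>: "partial_extension \<theta> \<Gamma>"
      and maximal: "\<And>\<Gamma>'. partial_extension \<theta> \<Gamma>' \<Longrightarrow> \<Gamma> \<subseteq> \<Gamma>' \<Longrightarrow> \<Gamma>' = \<Gamma>"
    using subset_Zorn_nonempty[of "{\<Gamma>. partial_extension \<theta> \<Gamma>}"] partial_extension_Union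
    by (metis (mono_tags, lifting) empty_iff mem_Collect_eq)
  interpret partial_extension \<theta> \<Gamma> by fact
  have "\<exists>w. (z, w) \<in> \<Gamma>" for z
    using extend_by_element[of z] maximal by force
  then obtain \<tau> where \<tau>: "\<And>z. (z, \<tau> z) \<in> \<Gamma>" by metis
  have eq: "\<tau> z = w" if "(z, w) \<in> \<Gamma>" for z w
    using functional \<tau> that by blast
  have "ring_morphism \<tau>"
    by unfold_locales (auto intro!: eq add mult one \<tau>)
  then show ?thesis using eq base by blast
qed

text \<open>The roots of a nonzero polynomial over the base form a finite set that
  \<open>\<tau>\<close> maps injectively into itself, hence onto itself; every element lies in such
  a set.\<close>

lemma alg_closure_endomorphism_surj:
  fixes \<tau> :: "'k::field alg_closure \<Rightarrow> 'k alg_closure"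
  assumes "ring_morphism \<tau>" and fixes_base: "\<And>c. \<tau> (to_ac c) = to_ac c"
  shows "surj \<tau>"
proof -
  interpret ring_morphism \<tau> by fact
  have "\<exists>x. y = \<tau> x" for y
  proof -
    obtain p where p: "p \<noteq> 0" "poly (map_poly to_ac p) y = 0"
      using alg_closure_algebraic by blast
    define R where "R = {x. poly (map_poly to_ac p) x = 0}"
    have "map_poly to_ac p \<noteq> 0"
      using p by (auto simp: poly_eq_iff coeff_map_poly)
    then have "finite R" unfolding R_def by (rule poly_roots_finite)
    have "poly (map_poly to_ac p) (\<tau> x) = \<tau> (poly (map_poly to_ac p) x)" for x
      by (induction p) (auto simp: map_poly_pCons map_zero map_add map_mult fixes_base)
    then have "\<tau> ` R \<subseteq> R"
      by (auto simp: R_def map_zero)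
    then have "\<tau> ` R = R"
      using \<open>finite R\<close> ring_morphism_field_inj[OF assms(1)]
      by (intro endo_inj_surj) (auto intro: inj_on_subset)
    then show ?thesis using p(2) by (auto simp: R_def)
  qed
  then show ?thesis unfolding surj_def by blast
qed

lemma automorphism_extends_to_alg_closure:
  fixes \<sigma> :: "'k::field \<Rightarrow> 'k"
  assumes "ring_morphism \<sigma>" "bij \<sigma>"
  shows "\<exists>\<tau>. ring_morphism \<tau> \<and> bij \<tau> \<and> (\<forall>c. \<tau> (to_ac c) = to_ac (\<sigma> c))"
proof -
  have ext: "\<exists>\<tau>::'k alg_closure \<Rightarrow> 'k alg_closure. ring_morphism \<tau> \<and> (\<forall>c. \<tau> (to_ac c) = to_ac (\<rho> c))"
    if "ring_morphism \<rho>" for \<rho> :: "'k \<Rightarrow> 'k"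
    using ring_morphism_extends_to_alg_closure[OF ring_morphism_comp[OF that ring_morphism_to_ac]]
    by simp
  obtain \<tau> where \<tau>: "ring_morphism \<tau>" "\<And>c. \<tau> (to_ac c) = to_ac (\<sigma> c)"
    using ext[OF assms(1)] by blast
  obtain \<tau>' where \<tau>': "ring_morphism \<tau>'" "\<And>c. \<tau>' (to_ac c) = to_ac (inv_into UNIV \<sigma> c)"
    using ext[OF ring_morphism_inv[OF assms]] by blast
  \<comment> \<open>On the base field the composite is \<open>\<sigma>\<close> after its inverse, so
    it fixes the base. It need not be the identity on the closure.\<close>
  have "surj (\<tau> \<circ> \<tau>')"
    using assms(2)
    by (intro alg_closure_endomorphism_surj ring_morphism_comp \<tau>' \<tau>)
      (simp add: \<tau> \<tau>' surj_f_inv_f bij_is_surj)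
  then have "surj \<tau>" by (auto simp: surj_def)
  then have "bij \<tau>"
    using ring_morphism_field_inj[OF \<tau>(1)] by (simp add: bij_def)
  with \<tau> show ?thesis by blast
qed


section \<open>Evaluation of multivariate polynomials\<close>

abbreviation monomial_value :: "('v \<Rightarrow> 'b::comm_semiring_1) \<Rightarrow> ('v \<Rightarrow>\<^sub>0 nat) \<Rightarrow> 'b" where
  "monomial_value x m \<equiv> \<Prod>v\<in>Poly_Mapping.keys m. x v ^ Poly_Mapping.lookup m v"

lemma monomial_value_superset:
  assumes "finite A" "Poly_Mapping.keys m \<subseteq> A"
  shows "monomial_value x m = (\<Prod>v\<in>A. x v ^ Poly_Mapping.lookup m v)"
  using assms by (intro prod.mono_neutral_left) (auto simp: in_keys_iff)

lemma monomial_value_add: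
  "monomial_value x (m + m') = monomial_value x m * monomial_value x m'"
proof -
  let ?A = "Poly_Mapping.keys m \<union> Poly_Mapping.keys m'"
  have "monomial_value x (m + m') = (\<Prod>v\<in>?A. x v ^ Poly_Mapping.lookup (m + m') v)"
    by (rule monomial_value_superset) (use Poly_Mapping.keys_add[of m m'] in auto)
  also have "\<dots> = (\<Prod>v\<in>?A. x v ^ Poly_Mapping.lookup m v) * (\<Prod>v\<in>?A. x v ^ Poly_Mapping.lookup m' v)"
    by (simp add: lookup_add power_add prod.distrib)
  also have "\<dots> = monomial_value x m * monomial_value x m'"
    using monomial_value_superset[of ?A m x] monomial_value_superset[of ?A m' x] by simp
  finally show ?thesis .
qed

lemma mpoly_sum_monomials:
  fixes f :: "('v, 'a::comm_monoid_add) mpoly"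
  shows "f = (\<Sum>m\<in>Poly_Mapping.keys f. Poly_Mapping.single m (Poly_Mapping.lookup f m))"
  by (rule poly_mapping_eqI)
    (auto simp: lookup_sum lookup_single when_def not_in_keys_iff_lookup_eq_zero)

lemma mpoly_induct [case_names single add]:
  fixes f :: "('v, 'a::comm_monoid_add) mpoly"
  assumes "\<And>m c. P (Poly_Mapping.single m c)" and "\<And>f g. P f \<Longrightarrow> P g \<Longrightarrow> P (f + g)"
  shows "P f"
proof -
  have "P 0" using assms(1)[of 0 0] by simp
  then have "P (\<Sum>m\<in>A. Poly_Mapping.single m (h m))" for A h
    by (induction A rule: infinite_finite_induct) (auto intro: assms)
  then show ?thesis by (subst mpoly_sum_monomials)
qed

lemma mpoly_subst_cong:
  assumes "\<And>v. v \<in> vars f \<Longrightarrow> x v = y v"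
  shows "mpoly_subst \<theta> x f = mpoly_subst \<theta> y f"
  unfolding mpoly_subst_def using assms
  by (intro sum.cong prod.cong arg_cong2[of _ _ _ _ "(*)"] arg_cong2[of _ _ _ _ "(^)"] refl)
    (auto simp: vars_def)

lemma mpoly_subst_restrict:
  "vars f \<subseteq> V \<Longrightarrow> mpoly_subst \<theta> (restrict x V) f = mpoly_subst \<theta> x f"
  by (intro mpoly_subst_cong) auto

lemma mpoly_subst_map:
  assumes "\<psi> 0 = 0" "\<theta> 0 = 0"
  shows "mpoly_subst \<theta> x (Poly_Mapping.map \<psi> f) = mpoly_subst (\<theta> \<circ> \<psi>) x f"
proof -
  have lookup: "Poly_Mapping.lookup (Poly_Mapping.map \<psi> f) m = \<psi> (Poly_Mapping.lookup f m)" for m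
    using assms(1) by (simp add: Poly_Mapping.map.rep_eq when_def)
  then have "Poly_Mapping.keys (Poly_Mapping.map \<psi> f) \<subseteq> Poly_Mapping.keys f"
    using assms(1) by (auto simp: in_keys_iff)
  then show ?thesis
    unfolding mpoly_subst_def lookup using assms lookup
    by (intro sum.mono_neutral_cong_left) (auto simp: in_keys_iff)
qed

lemma vars_map: "vars (Poly_Mapping.map \<psi> f) \<subseteq> vars f"
  by (auto simp: vars_def Poly_Mapping.map.rep_eq when_def in_keys_iff split: if_splits)

context ring_morphism
begin

lemma mpoly_subst_superset:
  assumes "finite A" "Poly_Mapping.keys f \<subseteq> A"
  shows "mpoly_subst \<theta> x f = (\<Sum>m\<in>A. \<theta> (Poly_Mapping.lookup f m) * monomial_value x m)"
  unfolding mpoly_subst_def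
  using assms by (intro sum.mono_neutral_left) (auto simp: in_keys_iff map_zero)

lemma mpoly_subst_add: "mpoly_subst \<theta> x (f + g) = mpoly_subst \<theta> x f + mpoly_subst \<theta> x g"
proof -
  let ?A = "Poly_Mapping.keys f \<union> Poly_Mapping.keys g"
  have "mpoly_subst \<theta> x (f + g) = (\<Sum>m\<in>?A. \<theta> (Poly_Mapping.lookup (f + g) m) * monomial_value x m)"
    by (rule mpoly_subst_superset) (use Poly_Mapping.keys_add[of f g] in auto)
  also have "\<dots> = (\<Sum>m\<in>?A. \<theta> (Poly_Mapping.lookup f m) * monomial_value x m) +
      (\<Sum>m\<in>?A. \<theta> (Poly_Mapping.lookup g m) * monomial_value x m)"
    by (simp add: lookup_add map_add distrib_right sum.distrib)
  also have "\<dots> = mpoly_subst \<theta> x f + mpoly_subst \<theta> x g"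
    using mpoly_subst_superset[of ?A f x] mpoly_subst_superset[of ?A g x] by simp
  finally show ?thesis .
qed

lemma mpoly_subst_single:
  "mpoly_subst \<theta> x (Poly_Mapping.single m c) = \<theta> c * monomial_value x m"
  by (auto simp: mpoly_subst_def map_zero)

lemma mpoly_subst_mult: "mpoly_subst \<theta> x (f * g) = mpoly_subst \<theta> x f * mpoly_subst \<theta> x g"
proof (induction f rule: mpoly_induct)
  case (single m c)
  show ?case
    by (induction g rule: mpoly_induct)
      (simp_all add: mult_single mpoly_subst_single map_mult monomial_value_add mpoly_subst_add
        algebra_simps)
qed (simp add: mpoly_subst_add distrib_right)

lemma mpoly_subst_Const: "mpoly_subst \<theta> x (Const c) = \<theta> c"
  by (simp add: Const_def mpoly_subst_single)

lemma mpoly_subst_Var: "mpoly_subst \<theta> x (Var v) = x v"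
  by (simp add: Var_def mpoly_subst_single map_one)

lemma ring_morphism_mpoly_subst: "ring_morphism (mpoly_subst \<theta> x)"
proof
  show "mpoly_subst \<theta> x 1 = 1"
    using mpoly_subst_Const[of x 1] by (simp add: Const_def map_one)
qed (auto simp: mpoly_subst_add mpoly_subst_mult)

lemma map_mpoly_subst: "\<theta> (mpoly_subst \<psi> x f) = mpoly_subst (\<theta> \<circ> \<psi>) (\<theta> \<circ> x) f"
  by (simp add: mpoly_subst_def map_sum map_mult map_prod map_power)

text \<open>Evaluation is itself a ring homomorphism, so \<open>map_mpoly_subst\<close> applies to
  it.\<close>

lemma mpoly_subst_mpoly_subst:
  "mpoly_subst \<theta> x (mpoly_subst Const y f) = mpoly_subst \<theta> (\<lambda>v. mpoly_subst \<theta> x (y v)) f"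
proof -
  interpret e: ring_morphism "mpoly_subst \<theta> x" by (rule ring_morphism_mpoly_subst)
  show ?thesis
    by (simp add: e.map_mpoly_subst comp_def mpoly_subst_Const)
qed

end

lemma ring_morphism_id: "ring_morphism id"
  by unfold_locales auto

section \<open>Variables occurring in a polynomial\<close>

lemma vars_0 [simp]: "vars 0 = {}"
  by (simp add: vars_def)

lemma vars_1 [simp]: "vars (1 :: ('v, 'a::zero_neq_one) mpoly) = {}"
  by (simp add: vars_def)

lemma vars_Const [simp]: "vars (Const c) = {}"
  by (simp add: vars_def Const_def)

lemma vars_Var [simp]: "vars (Var v :: ('v, 'a::zero_neq_one) mpoly) = {v}"
  by (simp add: vars_def Var_def)

lemma vars_add: "vars (f + g) \<subseteq> vars f \<union> vars g"
  using Poly_Mapping.keys_add[of f g] by (auto simp: vars_def)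

lemma vars_uminus [simp]: "vars (- f :: ('v, 'a::ab_group_add) mpoly) = vars f"
  by (simp add: vars_def in_keys_iff set_eq_iff)

lemma vars_mult: "vars (f * g :: ('v, 'a::semiring_0) mpoly) \<subseteq> vars f \<union> vars g"
proof
  fix v assume "v \<in> vars (f * g)"
  then obtain a b where "a \<in> Poly_Mapping.keys f" "b \<in> Poly_Mapping.keys g"
    and "v \<in> Poly_Mapping.keys (a + b)"
    using Poly_Mapping.keys_mult[of f g] by (auto simp: vars_def)
  then show "v \<in> vars f \<union> vars g"
    using Poly_Mapping.keys_add[of a b] by (auto simp: vars_def)
qed

lemma vars_sum:
  "(\<And>i. i \<in> I \<Longrightarrow> vars (f i) \<subseteq> V) \<Longrightarrow> vars (\<Sum>i\<in>I. f i) \<subseteq> V"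
  by (induction I rule: infinite_finite_induct) (auto dest!: subsetD[OF vars_add])

lemma vars_prod:
  fixes f :: "'i \<Rightarrow> ('v, 'a::comm_ring_1) mpoly"
  shows "(\<And>i. i \<in> I \<Longrightarrow> vars (f i) \<subseteq> V) \<Longrightarrow> vars (\<Prod>i\<in>I. f i) \<subseteq> V"
  by (induction I rule: infinite_finite_induct) (auto dest!: subsetD[OF vars_mult])

lemma vars_power: "vars (f ^ n :: ('v, 'a::comm_ring_1) mpoly) \<subseteq> vars f"
  by (induction n) (auto dest!: subsetD[OF vars_mult])

lemma vars_mpoly_subst:
  fixes y :: "'v \<Rightarrow> ('w, 'a::comm_ring_1) mpoly"
  assumes "\<And>v. v \<in> vars f \<Longrightarrow> vars (y v) \<subseteq> V"
  shows "vars (mpoly_subst Const y f) \<subseteq> V"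
  unfolding mpoly_subst_def
proof (rule vars_sum)
  fix m assume "m \<in> Poly_Mapping.keys f"
  then have "vars (monomial_value y m) \<subseteq> V"
    using assms vars_power by (intro vars_prod) (fastforce simp: vars_def[of f])
  then show "vars (Const (Poly_Mapping.lookup f m) * monomial_value y m) \<subseteq> V"
    using vars_mult[of "Const (Poly_Mapping.lookup f m)" "monomial_value y m"] by auto
qed

section \<open>The polynomial ring and its vanishing ideals\<close>

lemma cring_mpoly_ring: "cring (mpoly_ring V :: ('v, 'a::comm_ring_1) mpoly ring)"
proof (rule cringI)
  show "abelian_group (mpoly_ring V :: ('v, 'a) mpoly ring)"
  proof (rule abelian_groupI)
    fix f :: "('v, 'a) mpoly" assume "f \<in> carrier (mpoly_ring V)"
    then show "\<exists>g\<in>carrier (mpoly_ring V). g \<oplus>\<^bsub>mpoly_ring V\<^esub> f = \<zero>\<^bsub>mpoly_ring V\<^esub>"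
      by (intro bexI[of _ "- f"]) (auto simp: mpoly_ring_def)
  qed (auto simp: mpoly_ring_def add_ac dest!: subsetD[OF vars_add])
  show "Group.comm_monoid (mpoly_ring V :: ('v, 'a) mpoly ring)"
    by (rule comm_monoidI) (auto simp: mpoly_ring_def mult_ac dest!: subsetD[OF vars_mult])
qed (auto simp: mpoly_ring_def distrib_right)

text \<open>
  With \<open>\<theta> = id\<close> this is the vanishing ideal of \<open>Y\<close>.  In general the coefficients of the
  polynomials lie in a smaller ring than the coordinates of the points.
\<close>

definition vanishing_ideal_via ::
  "('a::comm_ring_1 \<Rightarrow> 'b::comm_ring_1) \<Rightarrow> 'v set \<Rightarrow> ('v \<Rightarrow> 'b) set \<Rightarrow> ('v, 'a) mpoly set"
  where "vanishing_ideal_via \<theta> V Y = {f. vars f \<subseteq> V \<and> (\<forall>x\<in>Y. mpoly_subst \<theta> x f = 0)}"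

lemma (in ring_morphism) ideal_vanishing_ideal_via:
  fixes V :: "'v set"
  shows "ideal (vanishing_ideal_via \<theta> V Y) (mpoly_ring V)"
proof -
  interpret R: cring "mpoly_ring V :: ('v, 'a) mpoly ring" by (rule cring_mpoly_ring)
  have neg: "\<ominus>\<^bsub>mpoly_ring V\<^esub> f = - f" if "vars f \<subseteq> V" for f :: "('v, 'a) mpoly"
    using that by (intro R.minus_equality) (auto simp: mpoly_ring_def)
  interpret e: ring_morphism "mpoly_subst \<theta> x" for x :: "'v \<Rightarrow> 'b"
    by (rule ring_morphism_mpoly_subst)
  show ?thesis
  proof (rule idealI)
    show "subgroup (vanishing_ideal_via \<theta> V Y) (add_monoid (mpoly_ring V))"
    proof
      fix f assume "f \<in> vanishing_ideal_via \<theta> V Y"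
      then show "inv\<^bsub>add_monoid (mpoly_ring V)\<^esub> f \<in> vanishing_ideal_via \<theta> V Y"
        using neg[of f] by (simp add: a_inv_def vanishing_ideal_via_def e.map_uminus)
    qed (auto simp: mpoly_ring_def vanishing_ideal_via_def e.map_zero e.map_add
        dest!: subsetD[OF vars_add])
  qed (rule R.ring_axioms, auto simp: mpoly_ring_def vanishing_ideal_via_def e.map_mult
      dest!: subsetD[OF vars_mult])
qed

section \<open>Irreducible sets\<close>

text \<open>Irreducibility is tested on functions instead of polynomials: freezing coordinates and
  conjugating by an automorphism then become inductions over these rules, without computing with
  coefficients.\<close>

inductive_set polynomial_functions :: "'v set \<Rightarrow> (('v \<Rightarrow> 'a::comm_ring_1) \<Rightarrow> 'a) set" for V where
  const: "(\<lambda>x. c) \<in> polynomial_functions V"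
| coordinate: "v \<in> V \<Longrightarrow> (\<lambda>x. x v) \<in> polynomial_functions V"
| add: "F \<in> polynomial_functions V \<Longrightarrow> F' \<in> polynomial_functions V \<Longrightarrow>
    (\<lambda>x. F x + F' x) \<in> polynomial_functions V"
| mult: "F \<in> polynomial_functions V \<Longrightarrow> F' \<in> polynomial_functions V \<Longrightarrow>
    (\<lambda>x. F x * F' x) \<in> polynomial_functions V"

lemma polynomial_functions_sum:
  "(\<And>i. i \<in> I \<Longrightarrow> F i \<in> polynomial_functions V) \<Longrightarrow> (\<lambda>x. \<Sum>i\<in>I. F i x) \<in> polynomial_functions V"
  by (induction I rule: infinite_finite_induct)
    (auto intro: polynomial_functions.const polynomial_functions.add)

lemma polynomial_functions_prod:
  "(\<And>i. i \<in> I \<Longrightarrow> F i \<in> polynomial_functions V) \<Longrightarrow> (\<lambda>x. \<Prod>i\<in>I. F i x) \<in> polynomial_functions V"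
  by (induction I rule: infinite_finite_induct)
    (auto intro: polynomial_functions.const polynomial_functions.mult)

lemma polynomial_functions_power:
  "F \<in> polynomial_functions V \<Longrightarrow> (\<lambda>x. F x ^ n) \<in> polynomial_functions V"
  by (induction n) (auto intro: polynomial_functions.const polynomial_functions.mult)

text \<open>Coefficients enter only as constants, so polynomials over the base field evaluated in
  its closure are covered.\<close>

lemma mpoly_subst_in_polynomial_functions:
  assumes "vars f \<subseteq> V"
  shows "(\<lambda>x. mpoly_subst \<theta> x f) \<in> polynomial_functions V"
  unfolding mpoly_subst_def using assms
  by (intro polynomial_functions_sum polynomial_functions.mult polynomial_functions.const
      polynomial_functions_prod polynomial_functions_power polynomial_functions.coordinate)
    (auto simp: vars_def)

lemma polynomial_functions_imp_mpoly:
  fixes F :: "('v \<Rightarrow> 'a::comm_ring_1) \<Rightarrow> 'a"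
  assumes "F \<in> polynomial_functions V"
  shows "\<exists>f. vars f \<subseteq> V \<and> (\<forall>x. mpoly_eval x f = F x)"
proof -
  interpret ring_morphism "id :: 'a \<Rightarrow> 'a" by (rule ring_morphism_id)
  show ?thesis
    using assms
  proof induction
    case (const c)
    show ?case
      by (rule exI[of _ "Const c"]) (simp add: mpoly_subst_Const del: id_apply, simp)
  next
    case (coordinate v)
    then show ?case
      by (intro exI[of _ "Var v"]) (simp add: mpoly_subst_Var del: id_apply)
  next
    case (add F F')
    then obtain f f' where "vars f \<subseteq> V" "\<forall>x. mpoly_eval x f = F x"
      "vars f' \<subseteq> V" "\<forall>x. mpoly_eval x f' = F' x" by blast
    then show ?case
      using vars_add[of f f'] by (intro exI[of _ "f + f'"]) (auto simp: mpoly_subst_add simp del: id_apply)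
  next
    case (mult F F')
    then obtain f f' where "vars f \<subseteq> V" "\<forall>x. mpoly_eval x f = F x"
      "vars f' \<subseteq> V" "\<forall>x. mpoly_eval x f' = F' x" by blast
    then show ?case
      using vars_mult[of f f'] by (intro exI[of _ "f * f'"]) (auto simp: mpoly_subst_mult simp del: id_apply)
  qed
qed

lemma polynomial_functions_cong:
  assumes "F \<in> polynomial_functions V" "\<And>v. v \<in> V \<Longrightarrow> x v = y v"
  shows "F x = F y"
  using assms by induction auto

text \<open>Freezing all factors but one at r allows the irreducibility of that single factor to be
  applied.\<close>

lemma polynomial_functions_slice:
  assumes "F \<in> polynomial_functions (H \<times> V)"
  shows "(\<lambda>x. F (\<lambda>(h, i). if h = g then x i else r (h, i))) \<in> polynomial_functions V"
  using assms
proof induction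
  case (coordinate v)
  then show ?case
    by (cases v; cases "fst v = g")
      (auto intro: polynomial_functions.const polynomial_functions.coordinate)
qed (auto intro: polynomial_functions.intros)

text \<open>Coordinates are unchanged and constants are moved by the inverse of
  \<open>\<tau>\<close>; this stands in for the action of an automorphism on coefficients.\<close>

lemma polynomial_functions_conjugate:
  assumes "F \<in> polynomial_functions V" "ring_morphism \<tau>" "bij \<tau>"
  shows "(\<lambda>x. inv_into UNIV \<tau> (F (\<tau> \<circ> x))) \<in> polynomial_functions V"
  using assms(1)
proof induction
  interpret i: ring_morphism "inv_into UNIV \<tau>" using assms by (intro ring_morphism_inv)
  case (coordinate v)
  have "(\<lambda>x. inv_into UNIV \<tau> ((\<tau> \<circ> x) v)) = (\<lambda>x. x v)"
    using assms(3) by (simp add: bij_is_inj)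
  then show ?case using coordinate by (simp add: polynomial_functions.coordinate)
next
  interpret i: ring_morphism "inv_into UNIV \<tau>" using assms by (intro ring_morphism_inv)
  case (add F F')
  then show ?case by (simp add: i.map_add polynomial_functions.add)
next
  interpret i: ring_morphism "inv_into UNIV \<tau>" using assms by (intro ring_morphism_inv)
  case (mult F F')
  then show ?case by (simp add: i.map_mult polynomial_functions.mult)
qed (rule polynomial_functions.const)

text \<open>Unlike Zariski irreducibility, this allows the empty set.\<close>

definition irreducible_set :: "'v set \<Rightarrow> ('v \<Rightarrow> 'a::comm_ring_1) set \<Rightarrow> bool" where
  "irreducible_set V Z \<longleftrightarrow>
    (\<forall>F\<in>polynomial_functions V. \<forall>F'\<in>polynomial_functions V.
      (\<forall>x\<in>Z. F x * F' x = 0) \<longrightarrow> (\<forall>x\<in>Z. F x = 0) \<or> (\<forall>x\<in>Z. F' x = 0))"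

lemma irreducible_setD:
  assumes "irreducible_set V Z" "F \<in> polynomial_functions V" "F' \<in> polynomial_functions V"
    and "\<And>x. x \<in> Z \<Longrightarrow> F x * F' x = 0"
  shows "(\<forall>x\<in>Z. F x = 0) \<or> (\<forall>x\<in>Z. F' x = 0)"
  using assms unfolding irreducible_set_def by blast

text \<open>The contrapositive: two nonempty principal open subsets meet.\<close>

lemma irreducible_set_nonvanishing:
  assumes "irreducible_set V Z" "F \<in> polynomial_functions V" "F' \<in> polynomial_functions V"
    and "x \<in> Z" "F x \<noteq> 0" "x' \<in> Z" "F' x' \<noteq> 0"
  shows "\<exists>y\<in>Z. F y * F' y \<noteq> 0"
  using assms unfolding irreducible_set_def by blast

text \<open>The set is \<open>\<tau>\<close>(Z). Functions on it pull back to conjugated polynomial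
  functions on Z with corresponding zeros.\<close>

lemma irreducible_set_conjugate:
  fixes \<tau> :: "'a::comm_ring_1 \<Rightarrow> 'a"
  assumes "irreducible_set V Z" and \<tau>: "ring_morphism \<tau>" "bij \<tau>"
  shows "irreducible_set V {x. inv_into UNIV \<tau> \<circ> x \<in> Z}"
  unfolding irreducible_set_def
proof (intro ballI impI)
  let ?i = "inv_into UNIV \<tau>"
  interpret i: ring_morphism ?i using \<tau> by (rule ring_morphism_inv)
  have \<tau>i: "\<tau> \<circ> (?i \<circ> x) = x" for x :: "'v \<Rightarrow> 'a"
    using \<tau> by (auto simp: fun_eq_iff surj_f_inv_f bij_is_surj)
  have i\<tau>: "?i \<circ> (\<tau> \<circ> x) = x" for x :: "'v \<Rightarrow> 'a"
    using \<tau> by (auto simp: fun_eq_iff bij_is_inj)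
  have i0: "?i a = 0 \<longleftrightarrow> a = 0" for a
    using i.map_zero bij_imp_bij_inv[OF \<tau>(2)] by (metis bij_is_inj injD)
  fix F F' assume F: "F \<in> polynomial_functions V" "F' \<in> polynomial_functions V"
    and "\<forall>x\<in>{x. ?i \<circ> x \<in> Z}. F x * F' x = 0"
  then have "\<forall>x\<in>Z. ?i (F (\<tau> \<circ> x)) * ?i (F' (\<tau> \<circ> x)) = 0"
    by (auto simp flip: i.map_mult simp: i\<tau> i0)
  then have "(\<forall>x\<in>Z. ?i (F (\<tau> \<circ> x)) = 0) \<or> (\<forall>x\<in>Z. ?i (F' (\<tau> \<circ> x)) = 0)"
    by (intro irreducible_setD[OF assms(1)] polynomial_functions_conjugate F \<tau>) blast
  then show "(\<forall>x\<in>{x. ?i \<circ> x \<in> Z}. F x = 0) \<or> (\<forall>x\<in>{x. ?i \<circ> x \<in> Z}. F' x = 0)"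
    unfolding i0 by (metis \<tau>i mem_Collect_eq)
qed

text \<open>Coordinates with first index outside H stay free; polynomial functions in
  \<open>H \<times> V\<close> do not see them.\<close>

definition product_points :: "'g set \<Rightarrow> ('g \<Rightarrow> ('i \<Rightarrow> 'a) set) \<Rightarrow> ('g \<times> 'i \<Rightarrow> 'a) set" where
  "product_points H Z = {r. \<forall>g\<in>H. (\<lambda>i. r (g, i)) \<in> Z g}"

text \<open>
  Two points at which \<open>F\<close> and \<open>F'\<close> respectively do not vanish are made equal one factor at a time.
\<close>

lemma irreducible_set_product:
  fixes Z :: "'g \<Rightarrow> ('i \<Rightarrow> 'a::idom) set"
  assumes "finite H" and irr: "\<And>g. g \<in> H \<Longrightarrow> irreducible_set V (Z g)"
  shows "irreducible_set (H \<times> V) (product_points H Z)"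
  unfolding irreducible_set_def
proof (intro ballI impI, rule ccontr)
  let ?P = "product_points H Z"
  fix F F' assume F: "F \<in> polynomial_functions (H \<times> V)" "F' \<in> polynomial_functions (H \<times> V)"
    and FF': "\<forall>x\<in>?P. F x * F' x = 0"
    and "\<not> ((\<forall>x\<in>?P. F x = 0) \<or> (\<forall>x\<in>?P. F' x = 0))"
  then obtain r r' where r: "r \<in> ?P" "F r \<noteq> 0" "r' \<in> ?P" "F' r' \<noteq> 0" by blast
  have "\<exists>s\<in>?P. \<exists>s'\<in>?P. F s \<noteq> 0 \<and> F' s' \<noteq> 0 \<and> (\<forall>h\<in>H'. \<forall>i. s (h, i) = s' (h, i))"
    if "finite H'" "H' \<subseteq> H" for H'
    using that
  proof (induction H' rule: finite_induct)
    case empty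
    then show ?case using r by blast
  next
    case (insert g H')
    then obtain s s' where s: "s \<in> ?P" "s' \<in> ?P" "F s \<noteq> 0" "F' s' \<noteq> 0"
      and agree: "\<And>h i. h \<in> H' \<Longrightarrow> s (h, i) = s' (h, i)" by auto
    define up where "up t x = (\<lambda>(h, i). if h = g then x i else t (h, i))"
      for t :: "'g \<times> 'i \<Rightarrow> 'a" and x
    have up_self: "up t (\<lambda>i. t (g, i)) = t" for t by (auto simp: up_def)
    have up_P: "up t x \<in> ?P" if "t \<in> ?P" "x \<in> Z g" for t x
      unfolding product_points_def
    proof (intro CollectI ballI)
      fix h assume "h \<in> H"
      then show "(\<lambda>i. up t x (h, i)) \<in> Z h"
        using that by (cases "h = g") (auto simp: product_points_def up_def)
    qed
    have "g \<in> H" using insert by simp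
    \<comment> \<open>The slices of F through s and of \<open>F'\<close> through \<open>s'\<close>
      are each nonzero somewhere on \<open>Z g\<close>, so they are nonzero at a common x, which
      becomes the new g-component of both points.\<close>
    have "\<exists>x\<in>Z g. F (up s x) * F' (up s' x) \<noteq> 0"
    proof (rule irreducible_set_nonvanishing[OF irr[OF \<open>g \<in> H\<close>]])
      show "(\<lambda>x. F (up s x)) \<in> polynomial_functions V" "(\<lambda>x. F' (up s' x)) \<in> polynomial_functions V"
        unfolding up_def using F by (auto intro: polynomial_functions_slice)
      show "(\<lambda>i. s (g, i)) \<in> Z g" "(\<lambda>i. s' (g, i)) \<in> Z g"
        using s \<open>g \<in> H\<close> by (auto simp: product_points_def)
    qed (use s in \<open>auto simp: up_self\<close>)
    then obtain x where "x \<in> Z g" "F (up s x) \<noteq> 0" "F' (up s' x) \<noteq> 0" by auto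
    moreover have "\<forall>h\<in>insert g H'. \<forall>i. up s x (h, i) = up s' x (h, i)"
      using agree by (auto simp: up_def)
    ultimately show ?case using up_P s by blast
  qed
  from this[OF \<open>finite H\<close>] obtain s s' where s: "s \<in> ?P" "s' \<in> ?P" "F s \<noteq> 0" "F' s' \<noteq> 0"
    "\<And>h i. h \<in> H \<Longrightarrow> s (h, i) = s' (h, i)" by auto
  then have "F' s = F' s'" by (intro polynomial_functions_cong[OF F(2)]) auto
  then show False using s FF' by force
qed


section \<open>Conjugates of a variety\<close>

text \<open>The cylinder over W is used because extensional points are not stable under
  \<open>\<tau>\<close>, which may move \<open>undefined\<close>. If a product vanishes on W, its
  factors cut out two closed pieces covering W.\<close>

lemma absolutely_irreducible_imp_irreducible_set:
  fixes W :: "(nat \<Rightarrow> 'f::field alg_closure) set"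
  assumes "algebraic_set {1..n} W" and irr: "absolutely_irreducible n W"
  shows "irreducible_set {1..n} {x. restrict x {1..n} \<in> W}"
  unfolding irreducible_set_def
proof (intro ballI impI)
  let ?V = "{1..n}"
  obtain T where T: "T \<subseteq> carrier (mpoly_ring ?V)" "W = zero_locus ?V T"
    using assms(1) by (auto simp: algebraic_set_def)
  fix F F' :: "(nat \<Rightarrow> 'f alg_closure) \<Rightarrow> 'f alg_closure"
  assume F: "F \<in> polynomial_functions ?V" "F' \<in> polynomial_functions ?V"
    and FF': "\<forall>x\<in>{x. restrict x ?V \<in> W}. F x * F' x = 0"
  have restrict: "F (restrict x ?V) = F x" "F' (restrict x ?V) = F' x" for x
    by (auto intro!: polynomial_functions_cong[OF F(1)] polynomial_functions_cong[OF F(2)])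
  have W_restrict: "restrict x ?V = x" if "x \<in> W" for x
    using that T by (auto simp: zero_locus_def affine_space_def PiE_restrict)
  obtain f f' where f: "vars f \<subseteq> ?V" "\<forall>x. mpoly_eval x f = F x"
    and f': "vars f' \<subseteq> ?V" "\<forall>x. mpoly_eval x f' = F' x"
    using polynomial_functions_imp_mpoly F by meson
  have locus: "zero_locus ?V (insert f T) = {x \<in> W. F x = 0}"
    "zero_locus ?V (insert f' T) = {x \<in> W. F' x = 0}"
    using f f' by (auto simp: zero_locus_def T)
  have "algebraic_set ?V {x \<in> W. F x = 0}" "algebraic_set ?V {x \<in> W. F' x = 0}"
    unfolding algebraic_set_def using T(1) f(1) f'(1)
    by (intro exI[of _ "insert f T"] exI[of _ "insert f' T"] conjI locus[symmetric];
        auto simp: mpoly_ring_def)+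
  moreover have "F x * F' x = 0" if "x \<in> W" for x
    using FF' W_restrict[OF that] that by simp
  then have "W = {x \<in> W. F x = 0} \<union> {x \<in> W. F' x = 0}" by auto
  ultimately have "W = {x \<in> W. F x = 0} \<or> W = {x \<in> W. F' x = 0}"
    using irr unfolding absolutely_irreducible_def by blast
  then show "(\<forall>x\<in>{x. restrict x ?V \<in> W}. F x = 0) \<or> (\<forall>x\<in>{x. restrict x ?V \<in> W}. F' x = 0)"
    using restrict by (metis (mono_tags, lifting) mem_Collect_eq)
qed

text \<open>A common zero x of S also kills the ideal generated by S. This is the full vanishing
  ideal of W, so it contains the equations T that define W over the closure.\<close>

lemma F_variety_equations:
  fixes W :: "(nat \<Rightarrow> 'f::field alg_closure) set"
  assumes "F_variety n W"
  obtains S :: "(nat, 'f) mpoly set"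
  where "\<And>s. s \<in> S \<Longrightarrow> vars s \<subseteq> {1..n}"
    and "\<And>x. restrict x {1..n} \<in> W \<longleftrightarrow> (\<forall>s\<in>S. mpoly_subst to_ac x s = 0)"
proof -
  let ?V = "{1..n}"
  let ?R = "mpoly_ring ?V :: (nat, 'f alg_closure) mpoly ring"
  obtain T where T: "T \<subseteq> carrier (mpoly_ring ?V)" "W = zero_locus ?V T"
    using assms by (auto simp: F_variety_def algebraic_set_def)
  obtain S :: "(nat, 'f) mpoly set" where S: "S \<subseteq> carrier (mpoly_ring ?V)"
    and gen: "vanishing_ideal ?V W = Idl\<^bsub>?R\<^esub> (Poly_Mapping.map to_ac ` S)"
    using assms by (auto simp: F_variety_def)
  interpret R: cring ?R by (rule cring_mpoly_ring)
  interpret ring_morphism "id :: 'f alg_closure \<Rightarrow> 'f alg_closure" by (rule ring_morphism_id)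
  have vars_S: "vars s \<subseteq> ?V" if "s \<in> S" for s
    using S that by (auto simp: mpoly_ring_def)
  have S_carrier: "Poly_Mapping.map to_ac ` S \<subseteq> carrier ?R"
    using vars_S vars_map by (fastforce simp: mpoly_ring_def)
  have map: "mpoly_eval x (Poly_Mapping.map to_ac s) = mpoly_subst to_ac x s" for x s
    using mpoly_subst_map[of to_ac id x s] by simp
  have "restrict x ?V \<in> W \<longleftrightarrow> (\<forall>s\<in>S. mpoly_subst to_ac x s = 0)" for x
  proof
    assume "restrict x ?V \<in> W"
    moreover have "Poly_Mapping.map to_ac ` S \<subseteq> vanishing_ideal ?V W"
      unfolding gen by (rule R.genideal_self[OF S_carrier])
    ultimately have "mpoly_eval (restrict x ?V) (Poly_Mapping.map to_ac s) = 0" if "s \<in> S" for s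
      using that by (auto simp: vanishing_ideal_def)
    then show "\<forall>s\<in>S. mpoly_subst to_ac x s = 0"
      by (simp add: map mpoly_subst_restrict[OF vars_S] del: One_nat_def)
  next
    assume "\<forall>s\<in>S. mpoly_subst to_ac x s = 0"
    then have "Poly_Mapping.map to_ac ` S \<subseteq> vanishing_ideal_via id ?V {x}"
      using S_carrier by (auto simp: vanishing_ideal_via_def map mpoly_ring_def)
    then have "vanishing_ideal ?V W \<subseteq> vanishing_ideal_via id ?V {x}"
      unfolding gen by (intro R.genideal_minimal ideal_vanishing_ideal_via)
    moreover have "T \<subseteq> vanishing_ideal ?V W"
      using T by (auto simp: vanishing_ideal_def zero_locus_def)
    ultimately have "\<forall>t\<in>T. mpoly_eval (restrict x ?V) t = 0"
      by (auto simp: vanishing_ideal_via_def mpoly_subst_restrict simp del: One_nat_def)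
    then show "restrict x ?V \<in> W"
      unfolding T(2) by (auto simp: zero_locus_def affine_space_def)
  qed
  with vars_S show ?thesis using that by blast
qed

section \<open>Conjugation under the group and the invariant prime ideal\<close>

lemma (in group) transformal_field_morphisms:
  assumes "transformal_field G \<sigma>"
  shows "g \<in> carrier G \<Longrightarrow> ring_morphism (\<sigma> g)"
    and "g \<in> carrier G \<Longrightarrow> bij (\<sigma> g)"
    and "g \<in> carrier G \<Longrightarrow> h \<in> carrier G \<Longrightarrow> \<sigma> (g \<otimes> h) = \<sigma> g \<circ> \<sigma> h"
    and "\<sigma> \<one> = id"
proof -
  have hom: "\<sigma> \<in> hom G ring_Aut" using assms by (simp add: transformal_field_def)
  show "ring_morphism (\<sigma> g)" if "g \<in> carrier G" for g
    using hom_in_carrier[OF hom that]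
    by unfold_locales
      (auto simp: ring_Aut_def ring_iso_def ring_hom_def ring_of_type_algebra_def)
  show bij: "bij (\<sigma> g)" if "g \<in> carrier G" for g
    using hom_in_carrier[OF hom that]
    by (auto simp: ring_Aut_def ring_iso_def ring_of_type_algebra_def)
  show comp: "\<sigma> (g \<otimes> h) = \<sigma> g \<circ> \<sigma> h" if "g \<in> carrier G" "h \<in> carrier G" for g h
    using hom_mult[OF hom that] by (simp add: ring_Aut_def)
  \<comment> \<open>\<open>hom\<close> states multiplicativity only; an injective idempotent map is
    the identity.\<close>
  have "\<sigma> \<one> (\<sigma> \<one> x) = \<sigma> \<one> x" for x
    using fun_cong[OF comp[OF one_closed one_closed], of x] by simp
  then show "\<sigma> \<one> = id"
    using bij_is_inj[OF bij[OF one_closed]] by (auto simp: fun_eq_iff dest: injD)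
qed

text \<open>
  The points at which all conjugates of \<open>S\<close> vanish.  Sets of equations over \<open>'k\<close> have conjugates
  under \<open>\<sigma>\<close>, although \<open>\<sigma>\<close> itself does not act on the algebraic closure.
\<close>

definition conjugate_locus ::
  "('g \<Rightarrow> 'k::field \<Rightarrow> 'k) \<Rightarrow> ('v, 'k) mpoly set \<Rightarrow> 'g \<Rightarrow> ('v \<Rightarrow> 'k alg_closure) set"
  where "conjugate_locus \<sigma> S g = {x. \<forall>s\<in>S. mpoly_subst (to_ac \<circ> \<sigma> g) x s = 0}"

lemma (in group) prime_invariant_ideal_of_conjugates:
  fixes \<sigma> :: "'a \<Rightarrow> 'k::field \<Rightarrow> 'k" and S :: "(nat, 'k) mpoly set" and n :: nat
  defines "U \<equiv> transformal_vars G n"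
  defines "I \<equiv> vanishing_ideal_via to_ac U (product_points (carrier G) (conjugate_locus \<sigma> S))"
  assumes fin: "finite (carrier G)" and \<sigma>: "transformal_field G \<sigma>"
    and irr: "irreducible_set {1..n} (conjugate_locus \<sigma> S \<one>)"
    and nonempty: "conjugate_locus \<sigma> S \<one> \<noteq> {}"
  shows "primeideal I (mpoly_ring U)" and "G_invariant G \<sigma> I" and "1 \<notin> I"
proof -
  let ?Z = "conjugate_locus \<sigma> S" and ?P = "product_points (carrier G) (conjugate_locus \<sigma> S)"
  note \<sigma>_morphism = transformal_field_morphisms[OF \<sigma>]
  \<comment> \<open>The extensions are chosen independently for each g and need not form a group
    action. Only \<open>\<sigma>\<close> has to be multiplicative.\<close>
  obtain \<tau> where \<tau>: "ring_morphism (\<tau> g)" "bij (\<tau> g)" "\<forall>c. \<tau> g (to_ac c) = to_ac (\<sigma> g c)"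
    if "g \<in> carrier G" for g
    using automorphism_extends_to_alg_closure[OF \<sigma>_morphism(1,2)] by metis
  define \<tau>' where "\<tau>' g = inv_into UNIV (\<tau> g)" for g
  have \<tau>_\<tau>': "\<tau> g (\<tau>' g a) = a" if "g \<in> carrier G" for g a
    using \<tau>[OF that] by (simp add: \<tau>'_def bij_is_surj surj_f_inv_f)
  have \<tau>_eq_0: "\<tau> g a = 0 \<longleftrightarrow> a = 0" if "g \<in> carrier G" for g a
    using \<tau>[OF that] ring_morphism.map_zero[OF \<tau>(1)[OF that]] by (metis bij_is_inj injD)
  \<comment> \<open>Applying \<open>\<tau> g\<close> to an equation of \<open>?Z h\<close> turns its
    coefficients from \<open>\<sigma> h\<close> into \<open>\<sigma> (g \<otimes> h)\<close>, so
    \<open>\<tau> g\<close> carries \<open>?Z h\<close> onto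
    \<open>?Z (g \<otimes> h)\<close>.\<close>
  have conj: "\<tau>' g \<circ> x \<in> ?Z h \<longleftrightarrow> x \<in> ?Z (g \<otimes> h)" if g: "g \<in> carrier G" and h: "h \<in> carrier G" for g h x
  proof -
    interpret \<tau>g: ring_morphism "\<tau> g" using \<tau> g by blast
    have "\<tau> g (mpoly_subst (to_ac \<circ> \<sigma> h) (\<tau>' g \<circ> x) s) = mpoly_subst (to_ac \<circ> \<sigma> (g \<otimes> h)) x s" for s
      unfolding \<tau>g.map_mpoly_subst
      using g h \<tau> \<tau>_\<tau>' by (simp add: comp_def \<sigma>_morphism)
    then show ?thesis
      using \<tau>_eq_0[OF g] by (simp add: conjugate_locus_def) metis
  qed
  interpret to_ac: ring_morphism to_ac by (rule ring_morphism_to_ac)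
  interpret e: ring_morphism "mpoly_subst to_ac r" for r :: "'a \<times> nat \<Rightarrow> 'k alg_closure"
    by (rule to_ac.ring_morphism_mpoly_subst)

  have "irreducible_set {1..n} (?Z g)" if "g \<in> carrier G" for g
    using irreducible_set_conjugate[OF irr \<tau>(1,2)[OF that]] conj[OF that one_closed]
    by (simp add: that flip: \<tau>'_def)
  then have irr_P: "irreducible_set U ?P"
    unfolding U_def transformal_vars_def by (rule irreducible_set_product[OF fin])

  obtain x\<^sub>0 where "x\<^sub>0 \<in> ?Z \<one>" using nonempty by blast
  \<comment> \<open>The conjugates of a single point of \<open>?Z \<one>\<close> show that the
    product is nonempty, so 1 does not vanish on it.\<close>
  have "(\<lambda>(g, i). \<tau> g (x\<^sub>0 i)) \<in> ?P"
    unfolding product_points_def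
  proof (intro CollectI ballI)
    fix g assume g: "g \<in> carrier G"
    have "\<tau>' g \<circ> (\<lambda>i. \<tau> g (x\<^sub>0 i)) = x\<^sub>0"
      using \<tau>[OF g] by (simp add: \<tau>'_def fun_eq_iff bij_is_inj)
    then show "(\<lambda>i. case (g, i) of (g, i) \<Rightarrow> \<tau> g (x\<^sub>0 i)) \<in> ?Z g"
      using conj[OF g one_closed, of "\<lambda>i. \<tau> g (x\<^sub>0 i)"] \<open>x\<^sub>0 \<in> ?Z \<one>\<close> g by simp
  qed
  then show "1 \<notin> I" by (auto simp: I_def vanishing_ideal_via_def e.map_one)

  show "primeideal I (mpoly_ring U)"
  proof (rule primeidealI)
    show "ideal I (mpoly_ring U)"
      unfolding I_def by (rule to_ac.ideal_vanishing_ideal_via)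
    show "cring (mpoly_ring U :: ('a \<times> nat, 'k) mpoly ring)" by (rule cring_mpoly_ring)
    show "carrier (mpoly_ring U) \<noteq> I"
      using \<open>1 \<notin> I\<close> by (auto simp: mpoly_ring_def)
    fix f f' :: "('a \<times> nat, 'k) mpoly"
    assume f: "f \<in> carrier (mpoly_ring U)" "f' \<in> carrier (mpoly_ring U)"
      and "f \<otimes>\<^bsub>mpoly_ring U\<^esub> f' \<in> I"
    then have "\<forall>r\<in>?P. mpoly_subst to_ac r f * mpoly_subst to_ac r f' = 0"
      by (simp add: mpoly_ring_def I_def vanishing_ideal_via_def e.map_mult)
    moreover have "(\<lambda>r. mpoly_subst to_ac r f) \<in> polynomial_functions U"
      "(\<lambda>r. mpoly_subst to_ac r f') \<in> polynomial_functions U"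
      using f by (auto simp: mpoly_ring_def intro: mpoly_subst_in_polynomial_functions)
    ultimately have "(\<forall>r\<in>?P. mpoly_subst to_ac r f = 0) \<or> (\<forall>r\<in>?P. mpoly_subst to_ac r f' = 0)"
      by (intro irreducible_setD[OF irr_P]) blast+
    then show "f \<in> I \<or> f' \<in> I"
      using f by (simp add: mpoly_ring_def I_def vanishing_ideal_via_def)
  qed

  show "G_invariant G \<sigma> I"
    unfolding G_invariant_def
  proof (intro ballI image_subsetI)
    fix g f assume g: "g \<in> carrier G" and f: "f \<in> I"
    interpret \<tau>g: ring_morphism "\<tau> g" using \<tau> g by blast
    have vars_f: "vars f \<subseteq> U" using f by (simp add: I_def vanishing_ideal_via_def)
    have "vars (poly_action G \<sigma> g f) \<subseteq> U"
      unfolding poly_action_def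
      using vars_f vars_map[of "\<sigma> g" f] g
      by (intro vars_mpoly_subst) (auto simp: U_def transformal_vars_def)
    moreover have "mpoly_subst to_ac r (poly_action G \<sigma> g f) = 0" if r: "r \<in> ?P" for r
    proof -
      \<comment> \<open>Acting on f and evaluating at r amounts to evaluating f at \<open>r'\<close>
        and applying \<open>\<tau> g\<close>. By \<open>conj\<close>, the shift of the index by g
        compensates the inverse conjugation, so \<open>r'\<close> stays in the product.\<close>
      define r' where "r' = (\<lambda>(h, i). \<tau>' g (r (g \<otimes> h, i)))"
      have "mpoly_subst to_ac r (poly_action G \<sigma> g f) =
          mpoly_subst (to_ac \<circ> \<sigma> g) (\<lambda>(h, i). r (g \<otimes> h, i)) f"
        unfolding poly_action_def to_ac.mpoly_subst_mpoly_subst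
        using ring_morphism.map_zero[OF \<sigma>_morphism(1)[OF g]]
        by (simp add: mpoly_subst_map case_prod_unfold to_ac.mpoly_subst_Var)
      also have "\<dots> = mpoly_subst (\<tau> g \<circ> to_ac) (\<tau> g \<circ> r') f"
        using \<tau>(3)[OF g] \<tau>_\<tau>'[OF g] by (simp add: comp_def r'_def case_prod_unfold)
      also have "\<dots> = \<tau> g (mpoly_subst to_ac r' f)"
        by (simp add: \<tau>g.map_mpoly_subst)
      also have "r' \<in> ?P"
        unfolding product_points_def
      proof (intro CollectI ballI)
        fix h assume h: "h \<in> carrier G"
        then have "(\<lambda>i. r (g \<otimes> h, i)) \<in> ?Z (g \<otimes> h)"
          using r g by (auto simp: product_points_def)
        then show "(\<lambda>i. r' (h, i)) \<in> ?Z h"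
          using conj[OF g h, of "\<lambda>i. r (g \<otimes> h, i)"] by (simp add: r'_def comp_def)
      qed
      then have "mpoly_subst to_ac r' f = 0"
        using f by (simp add: I_def vanishing_ideal_via_def)
      finally show ?thesis by (simp add: \<tau>g.map_zero)
    qed
    ultimately show "poly_action G \<sigma> g f \<in> I"
      by (simp add: I_def vanishing_ideal_via_def)
  qed
qed

section \<open>A rational point on every absolutely irreducible variety\<close>

theorem corollary3p17:
  fixes G :: "('g, 'm) monoid_scheme"
    and \<sigma> :: "'g \<Rightarrow> 'k::field \<Rightarrow> 'k"
  assumes "group G"
    and "finite (carrier G)"
    and "model_G_TCF G \<sigma>"
  shows "PAC_field TYPE('k)"
  unfolding PAC_field_def
proof (intro allI impI, elim conjE)
  fix n and W :: "(nat \<Rightarrow> 'k alg_closure) set"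
  assume W: "F_variety n W" "absolutely_irreducible n W"
  interpret group G by fact
  show "\<exists>x\<in>W. F_rational n x"
  proof (cases "n = 0")
    \<comment> \<open>The axioms of G-TCF concern positive n only; without coordinates every point
      is rational.\<close>
    case True
    then show ?thesis using W(2) by (auto simp: absolutely_irreducible_def F_rational_def)
  next
    case False
    let ?V = "{1..n}" and ?U = "transformal_vars G n"
    have \<sigma>: "transformal_field G \<sigma>" using assms(3) by (simp add: model_G_TCF_def)
    note \<sigma>_morphism = transformal_field_morphisms[OF \<sigma>]
    obtain S :: "(nat, 'k) mpoly set" where vars_S: "\<And>s. s \<in> S \<Longrightarrow> vars s \<subseteq> ?V"
      and S: "\<And>x. restrict x ?V \<in> W \<longleftrightarrow> (\<forall>s\<in>S. mpoly_subst to_ac x s = 0)"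
      using F_variety_equations[OF W(1)] by blast
    have Z1: "conjugate_locus \<sigma> S \<one>\<^bsub>G\<^esub> = {x. restrict x ?V \<in> W}"
      unfolding conjugate_locus_def S by (simp add: \<sigma>_morphism)
    have alg: "algebraic_set ?V W" using W(1) by (simp add: F_variety_def)
    have irr: "irreducible_set ?V (conjugate_locus \<sigma> S \<one>\<^bsub>G\<^esub>)"
      unfolding Z1 by (rule absolutely_irreducible_imp_irreducible_set[OF alg W(2)])
    obtain w where "w \<in> W" using W(2) by (auto simp: absolutely_irreducible_def)
    moreover have "restrict w ?V = w"
      using \<open>w \<in> W\<close> alg
      by (auto simp: algebraic_set_def zero_locus_def affine_space_def PiE_restrict)
    ultimately have nonempty: "conjugate_locus \<sigma> S \<one>\<^bsub>G\<^esub> \<noteq> {}" unfolding Z1 by (metis (mono_tags) empty_iff mem_Collect_eq)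
    define I where "I = vanishing_ideal_via to_ac ?U
      (product_points (carrier G) (conjugate_locus \<sigma> S))"
    note I = prime_invariant_ideal_of_conjugates[OF assms(2) \<sigma> irr nonempty, folded I_def]
    let ?R = "mpoly_ring ?U :: ('g \<times> nat, 'k) mpoly ring"
    interpret R: cring ?R by (rule cring_mpoly_ring)
    have "ideal I ?R" using I(1) by (simp add: primeideal_def)
    moreover have "I \<subset> carrier ?R"
      using I(3) by (auto simp: I_def vanishing_ideal_via_def mpoly_ring_def)
    ultimately obtain a where "sigma_bar G \<sigma> n a \<in> zero_locus ?U I"
      using assms(3) I(1,2) R.oneideal False unfolding model_G_TCF_def
      by (metis DiffD1 One_nat_def Suc_leI not_gr_zero)
    then have a: "mpoly_eval (sigma_bar G \<sigma> n a) f = 0" if "f \<in> I" for f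
      using that by (simp add: zero_locus_def)
    interpret id: ring_morphism "id :: 'k \<Rightarrow> 'k" by (rule ring_morphism_id)
    interpret to_ac: ring_morphism to_ac by (rule ring_morphism_to_ac)
    have "mpoly_subst to_ac (to_ac \<circ> a) s = 0" if "s \<in> S" for s
    proof -
      \<comment> \<open>This copy of s uses only the neutral block of variables; it vanishes on the
        product because the neutral component lies in
        \<open>conjugate_locus \<sigma> S \<one>\<close>.\<close>
      let ?s = "mpoly_subst Const (\<lambda>i. Var (\<one>\<^bsub>G\<^esub>, i)) s :: ('g \<times> nat, 'k) mpoly"
      have "vars ?s \<subseteq> ?U"
        using vars_S[OF that] by (intro vars_mpoly_subst) (auto simp: transformal_vars_def)
      moreover have "mpoly_subst to_ac r ?s = 0"
        if "r \<in> product_points (carrier G) (conjugate_locus \<sigma> S)" for r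
        using that \<open>s \<in> S\<close>
        by (auto simp: to_ac.mpoly_subst_mpoly_subst to_ac.mpoly_subst_Var product_points_def
            conjugate_locus_def \<sigma>_morphism dest!: bspec[OF _ one_closed])
      ultimately have "?s \<in> I" by (simp add: I_def vanishing_ideal_via_def)
      then have "0 = mpoly_eval (\<lambda>i. sigma_bar G \<sigma> n a (\<one>\<^bsub>G\<^esub>, i)) s"
        using a[of ?s] by (simp add: id.mpoly_subst_mpoly_subst id.mpoly_subst_Var del: id_apply)
      \<comment> \<open>The neutral block of \<open>sigma_bar G \<sigma> n a\<close> is a itself, as
        \<open>\<sigma> \<one> = id\<close>.\<close>
      also have "\<dots> = mpoly_eval a s"
        using vars_S[OF that]
        by (intro mpoly_subst_cong) (auto simp: sigma_bar_def transformal_vars_def \<sigma>_morphism)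
      finally have "to_ac (mpoly_eval a s) = 0" by simp
      then show ?thesis by (simp add: to_ac.map_mpoly_subst del: id_apply)
    qed
    then have "restrict (to_ac \<circ> a) ?V \<in> W" using S by blast
    then show ?thesis by (intro bexI) (auto simp: F_rational_def)
  qed
qed

end
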